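(* Let $A$ be a $C^*$-algebra that is generated by its commutators as a ring, and let $L$ be a Lie ideal in $A$. Then $L$ is fully noncentral if and only if $L$ is not contained in any prime Lie ideal of $A$.
   Context: A $C^*$-algebra $A$ need not be unital. For $a,b\in A$ put $[a,b]:=ab-ba$ (a commutator); for subsets $E,F\subseteq A$, $[E,F]$ denotes the linear span of $\{[a,b]:a\in E,b\in F\}$. $A$ is generated by its commutators as a ring if every element of $A$ is a finite sum of finite products of commutators of elements of $A$ (no closure is taken). A two-sided ideal in $A$ is a linear subspace $I\subseteq A$ (not necessarily closed) with $ax,xa\in I$ for all $a\in A$, $x\in I$. A Lie ideal in $A$ is a linear subspace $L\subseteq A$ (not necessarily closed) with $[A,L]\subseteq L$. A Lie ideal $L$ is prime if $L\neq A$ and, for all Lie ideals $K_1,K_2\subseteq A$ with $[K_1,K_2]\subseteq L$, one has $K_1\subseteq L$ or $K_2\subseteq L$. A Lie ideal $L$ in $A$ is fully noncentral if there is no proper two-sided ideal $I\subsetneq A$ such that the image of $L$ in $A/I$ is contained in the center of $A/I$ (equivalently, $A$ is generated by $[A,L]$ as a two-sided ideal). *)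

theory Defs
  imports Complex_Main "HOL-Library.Set_Algebras"
begin

text \<open>
  The algebra is the whole type. The class \<open>real_normed_algebra\<close> does not ask for a unit, and
  nothing here excludes the zero algebra.
\<close>

class cstar_algebra = real_normed_algebra + banach +
  fixes scaleC :: "complex \<Rightarrow> 'a \<Rightarrow> 'a" (infixr \<open>*\<^sub>C\<close> 75)
    and star :: "'a \<Rightarrow> 'a"
  assumes scaleC_of_real: "complex_of_real r *\<^sub>C x = r *\<^sub>R x"
    and scaleC_add_right: "c *\<^sub>C (x + y) = c *\<^sub>C x + c *\<^sub>C y"
    and scaleC_add_left: "(c + d) *\<^sub>C x = c *\<^sub>C x + d *\<^sub>C x"
    and scaleC_scaleC: "c *\<^sub>C d *\<^sub>C x = (c * d) *\<^sub>C x"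
    and mult_scaleC_left: "(c *\<^sub>C x) * y = c *\<^sub>C (x * y)"
    and mult_scaleC_right: "x * (c *\<^sub>C y) = c *\<^sub>C (x * y)"
    and norm_scaleC: "norm (c *\<^sub>C x) = cmod c * norm x"
    and star_star: "star (star x) = x"
    and star_add: "star (x + y) = star x + star y"
    and star_scaleC: "star (c *\<^sub>C x) = cnj c *\<^sub>C star x"
    and star_mult: "star (x * y) = star y * star x"
    and norm_star_mult_self: "norm (star x * x) = (norm x)\<^sup>2"

lemma scaleC_one: "1 *\<^sub>C x = (x :: 'a::cstar_algebra)"
  using scaleC_of_real[of 1 x] by simp

global_interpretation complex_vector:
  vector_space "scaleC :: complex \<Rightarrow> 'a \<Rightarrow> 'a::cstar_algebra"
  defines csubspace = complex_vector.subspace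
    and cspan = complex_vector.span
  by unfold_locales
    (simp_all add: scaleC_add_right scaleC_add_left scaleC_scaleC scaleC_one)

instantiation complex :: cstar_algebra
begin

definition scaleC_complex :: "complex \<Rightarrow> complex \<Rightarrow> complex"
  where "scaleC_complex c x = c * x"

definition star_complex :: "complex \<Rightarrow> complex"
  where "star_complex = cnj"

instance
  by standard
    (simp_all add: scaleC_complex_def star_complex_def algebra_simps norm_mult power2_eq_square
      scaleR_conv_of_real)

end

definition commutator :: "'a::cstar_algebra \<Rightarrow> 'a \<Rightarrow> 'a"
  where "commutator a b = a * b - b * a"

definition commutator_span :: "'a::cstar_algebra set \<Rightarrow> 'a set \<Rightarrow> 'a set"
  where "commutator_span E F = cspan {commutator a b | a b. a \<in> E \<and> b \<in> F}"

text \<open>Products have at least one factor, since there may be no unit.\<close>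

inductive_set commutator_products :: "'a::cstar_algebra set" where
  single: "commutator a b \<in> commutator_products"
| mult: "p \<in> commutator_products \<Longrightarrow> p * commutator a b \<in> commutator_products"

definition generated_by_commutators :: "'a::cstar_algebra itself \<Rightarrow> bool"
  where "generated_by_commutators _ \<longleftrightarrow>
    (\<forall>x::'a. \<exists>ps. set ps \<subseteq> commutator_products \<and> x = sum_list ps)"

definition two_sided_ideal :: "'a::cstar_algebra set \<Rightarrow> bool"
  where "two_sided_ideal I \<longleftrightarrow> csubspace I \<and> (\<forall>a. \<forall>x\<in>I. a * x \<in> I \<and> x * a \<in> I)"

definition lie_ideal :: "'a::cstar_algebra set \<Rightarrow> bool"
  where "lie_ideal L \<longleftrightarrow> csubspace L \<and> commutator_span UNIV L \<subseteq> L"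

definition prime_lie_ideal :: "'a::cstar_algebra set \<Rightarrow> bool"
  where "prime_lie_ideal L \<longleftrightarrow> lie_ideal L \<and> L \<noteq> UNIV \<and>
    (\<forall>K1 K2. lie_ideal K1 \<longrightarrow> lie_ideal K2 \<longrightarrow> commutator_span K1 K2 \<subseteq> L \<longrightarrow>
      K1 \<subseteq> L \<or> K2 \<subseteq> L)"

text \<open>
  Elements of the quotient by \<open>I\<close> are the cosets \<open>x +o I\<close>. For cosets \<open>X\<close> and \<open>Y\<close> the set
  \<open>X * Y\<close> of all products need not be a whole coset, so their product in the quotient is
  \<open>X * Y + I\<close>.
\<close>

definition quotient_carrier :: "'a::cstar_algebra set \<Rightarrow> 'a set set"
  where "quotient_carrier I = range (\<lambda>x. x +o I)"

definition quotient_mult :: "'a::cstar_algebra set \<Rightarrow> 'a set \<Rightarrow> 'a set \<Rightarrow> 'a set"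
  where "quotient_mult I X Y = X * Y + I"

lemma quotient_mult_coset:
  assumes "two_sided_ideal I"
  shows "quotient_mult I (x +o I) (y +o I) = (x * y) +o I"
proof (intro set_eqI iffI)
  have add: "a + b \<in> I" if "a \<in> I" "b \<in> I" for a b
    using assms that complex_vector.subspace_add unfolding two_sided_ideal_def by blast
  have zero: "0 \<in> I"
    using assms complex_vector.subspace_0 unfolding two_sided_ideal_def by blast
  have mult: "a * b \<in> I" "b * a \<in> I" if "b \<in> I" for a b
    using assms that unfolding two_sided_ideal_def by blast+
  fix z
  {
    assume "z \<in> quotient_mult I (x +o I) (y +o I)"
    then obtain i j k where "i \<in> I" "j \<in> I" "k \<in> I" and z: "z = (x + i) * (y + j) + k"
      unfolding quotient_mult_def set_plus_def set_times_def elt_set_plus_def by blast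
    then have "x * j + i * y + i * j + k \<in> I"
      by (intro add mult)
    moreover have "z = x * y + (x * j + i * y + i * j + k)"
      unfolding z by (simp add: algebra_simps)
    ultimately show "z \<in> (x * y) +o I"
      unfolding elt_set_plus_def by blast
  next
    assume "z \<in> (x * y) +o I"
    then obtain k where k: "k \<in> I" "z = x * y + k"
      unfolding elt_set_plus_def by blast
    have "x \<in> x +o I" "y \<in> y +o I"
      using zero unfolding elt_set_plus_def by force+
    then show "z \<in> quotient_mult I (x +o I) (y +o I)"
      unfolding quotient_mult_def k by (intro set_plus_intro set_times_intro k)
  }
qed

definition quotient_center :: "'a::cstar_algebra set \<Rightarrow> 'a set set"
  where "quotient_center I = {X \<in> quotient_carrier I.
    \<forall>Y\<in>quotient_carrier I. quotient_mult I X Y = quotient_mult I Y X}"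

definition fully_noncentral :: "'a::cstar_algebra set \<Rightarrow> bool"
  where "fully_noncentral L \<longleftrightarrow>
    \<not> (\<exists>I. two_sided_ideal I \<and> I \<noteq> UNIV \<and> (\<lambda>x. x +o I) ` L \<subseteq> quotient_center I)"

end

theory Submission
  imports Defs
begin

text \<open>
  Both directions pass through prime two-sided ideals \<open>Q\<close> (not necessarily closed). Modulo such
  an ideal, Herstein's arguments show that a commutative Lie ideal is central
  (\<open>prime_ideal_lie_ideal_commutative\<close>) and that of two Lie ideals with central commutators one is
  central (\<open>prime_ideal_lie_ideals\<close>). Therefore the elements that are central modulo \<open>Q\<close> form a
  prime Lie ideal, which is proper because commutators generate the ring
  (\<open>prime_lie_ideal_of_prime_ideal\<close>). If \<open>L\<close> is not fully noncentral, then it is central modulo some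
  proper ideal \<open>I\<close>, so for any prime \<open>Q\<close> above \<open>I\<close> this prime Lie ideal contains \<open>L\<close>.

  Conversely, if \<open>L\<close> is fully noncentral, then it contains all commutators
  (\<open>commutators_in_fully_noncentral\<close>): all commutators with elements of the ideal generated by
  \<open>[L, L]\<close> lie in \<open>L\<close>, and this ideal is the whole algebra, because otherwise \<open>L\<close> would be
  commutative and hence central modulo a prime ideal. A Lie ideal \<open>P\<close> that contains \<open>L\<close> then contains \<open>[A, A]\<close>, and it is
  not prime, as one sees by taking the whole algebra for both Lie ideals in the definition.

  What is left is analytic: each proper ideal \<open>I\<close> lies in a proper prime ideal
  (\<open>prime_ideal_above\<close>). As there may be no unit, this needs an element none of whose powers is in
  \<open>I\<close>, and in a Banach algebra such an element need not exist. In a \<open>C\<^sup>*\<close>-algebra a skew-adjoint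
  \<open>u \<notin> I\<close> of small norm has a Cayley transform \<open>w\<close> in the unitization; it is unitary, its powers
  are bounded, and \<open>1 - w\<close> is an element of the algebra outside \<open>I\<close>. For every power-bounded \<open>w\<close>,
  Cohen's factorization method yields one \<open>y\<close> such that \<open>1 - w\<close> is a multiple of every power of
  \<open>y\<close> (\<open>power_factorization\<close>), so that no power of \<open>y\<close> is in \<open>I\<close>.
\<close>

section \<open>Two-sided ideals, Lie ideals and commutators\<close>

lemma two_sided_idealI:
  assumes "0 \<in> I" "\<And>x y. x \<in> I \<Longrightarrow> y \<in> I \<Longrightarrow> x + y \<in> I"
    "\<And>c x. x \<in> I \<Longrightarrow> c *\<^sub>C x \<in> I"
    "\<And>a x. x \<in> I \<Longrightarrow> a * x \<in> I" "\<And>a x. x \<in> I \<Longrightarrow> x * a \<in> I"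
  shows "two_sided_ideal I"
  unfolding two_sided_ideal_def complex_vector.subspace_def using assms by simp

lemma
  assumes "two_sided_ideal I"
  shows ideal_0: "0 \<in> I"
    and ideal_add: "x \<in> I \<Longrightarrow> y \<in> I \<Longrightarrow> x + y \<in> I"
    and ideal_diff: "x \<in> I \<Longrightarrow> y \<in> I \<Longrightarrow> x - y \<in> I"
    and ideal_minus: "x \<in> I \<Longrightarrow> - x \<in> I"
    and ideal_scaleC: "x \<in> I \<Longrightarrow> c *\<^sub>C x \<in> I"
    and ideal_scaleR: "x \<in> I \<Longrightarrow> r *\<^sub>R x \<in> I"
    and ideal_mult_left: "x \<in> I \<Longrightarrow> a * x \<in> I"
    and ideal_mult_right: "x \<in> I \<Longrightarrow> x * a \<in> I"
proof -
  have sub: "csubspace I" using assms unfolding two_sided_ideal_def by blast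
  show "0 \<in> I" by (rule complex_vector.subspace_0[OF sub])
  show "x + y \<in> I" if "x \<in> I" "y \<in> I" by (rule complex_vector.subspace_add[OF sub that])
  show "x - y \<in> I" if "x \<in> I" "y \<in> I" by (rule complex_vector.subspace_diff[OF sub that])
  show "- x \<in> I" if "x \<in> I" by (rule complex_vector.subspace_neg[OF sub that])
  show "c *\<^sub>C x \<in> I" if "x \<in> I" for c
    by (rule complex_vector.subspace_scale[OF sub that])
  then show "r *\<^sub>R x \<in> I" if "x \<in> I" using that unfolding scaleC_of_real[symmetric] by blast
  show "a * x \<in> I" "x * a \<in> I" if "x \<in> I"
    using assms that unfolding two_sided_ideal_def by blast+
qed

lemma ideal_commutator: "two_sided_ideal I \<Longrightarrow> x \<in> I \<Longrightarrow> commutator a x \<in> I"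
  unfolding commutator_def by (simp add: ideal_diff ideal_mult_left ideal_mult_right)

lemma commutator_in_commutator_span:
  "x \<in> E \<Longrightarrow> y \<in> F \<Longrightarrow> commutator x y \<in> commutator_span E F"
  unfolding commutator_span_def by (rule complex_vector.span_base) auto

lemma lie_ideal_iff:
  "lie_ideal L \<longleftrightarrow> csubspace L \<and> (\<forall>a. \<forall>x\<in>L. commutator a x \<in> L)"
proof -
  have "commutator_span UNIV L \<subseteq> L \<longleftrightarrow> (\<forall>a. \<forall>x\<in>L. commutator a x \<in> L)" if "csubspace L"
  proof
    assume "commutator_span UNIV L \<subseteq> L"
    then show "\<forall>a. \<forall>x\<in>L. commutator a x \<in> L"
      using commutator_in_commutator_span[OF UNIV_I] by (meson subsetD)
  next
    assume "\<forall>a. \<forall>x\<in>L. commutator a x \<in> L"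
    then show "commutator_span UNIV L \<subseteq> L"
      unfolding commutator_span_def by (intro complex_vector.span_minimal that) auto
  qed
  then show ?thesis unfolding lie_ideal_def by meson
qed

lemma lie_ideal_subspace: "lie_ideal L \<Longrightarrow> csubspace L"
  and lie_ideal_commutator: "lie_ideal L \<Longrightarrow> x \<in> L \<Longrightarrow> commutator a x \<in> L"
  by (simp_all add: lie_ideal_iff)

lemma
  shows commutator_add_left: "commutator (a + b) x = commutator a x + commutator b x"
    and commutator_add_right: "commutator a (x + y) = commutator a x + commutator a y"
    and commutator_scaleC_left: "commutator (c *\<^sub>C a) x = c *\<^sub>C commutator a x"
    and commutator_scaleC_right: "commutator a (c *\<^sub>C x) = c *\<^sub>C commutator a x"
    and commutator_0_right [simp]: "commutator a 0 = 0"
    and commutator_0_left [simp]: "commutator 0 a = 0"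
    and commutator_swap: "commutator a x = - commutator x a"
  unfolding commutator_def
  by (simp_all add: algebra_simps mult_scaleC_left mult_scaleC_right
      complex_vector.scale_right_diff_distrib)

lemma lie_ideal_commutator': "lie_ideal L \<Longrightarrow> x \<in> L \<Longrightarrow> commutator x a \<in> L"
  by (metis commutator_swap complex_vector.subspace_neg lie_ideal_commutator lie_ideal_subspace)

lemma coset_eq_iff:
  assumes "two_sided_ideal I"
  shows "x +o I = y +o I \<longleftrightarrow> x - y \<in> I"
proof
  assume "x +o I = y +o I"
  moreover have "x \<in> x +o I"
    using ideal_0[OF assms] unfolding elt_set_plus_def by force
  ultimately obtain i where "i \<in> I" "x = y + i" unfolding elt_set_plus_def by blast
  then show "x - y \<in> I" by simp
next
  have sub: "x +o I \<subseteq> y +o I" if "x - y \<in> I" for x y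
  proof
    fix z assume "z \<in> x +o I"
    then obtain i where "i \<in> I" "z = x + i" unfolding elt_set_plus_def by blast
    then have "z = y + ((x - y) + i)" "(x - y) + i \<in> I" using ideal_add[OF assms that] by auto
    then show "z \<in> y +o I" unfolding elt_set_plus_def by blast
  qed
  assume "x - y \<in> I"
  then show "x +o I = y +o I" using sub[of x y] sub[of y x] ideal_minus[OF assms] by force
qed

text \<open>A coset is central exactly if all commutators with a representative lie in the ideal; this
  removes the quotient from the definition.\<close>

lemma fully_noncentral_iff:
  "fully_noncentral L \<longleftrightarrow>
    \<not> (\<exists>I. two_sided_ideal I \<and> I \<noteq> UNIV \<and> (\<forall>x\<in>L. \<forall>a. commutator a x \<in> I))"
proof -
  have "x +o I \<in> quotient_center I \<longleftrightarrow> (\<forall>a. commutator a x \<in> I)"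
    if I: "two_sided_ideal I" for x :: 'a and I
  proof -
    have "x +o I \<in> quotient_center I \<longleftrightarrow> (\<forall>a. commutator x a \<in> I)"
      unfolding quotient_center_def quotient_carrier_def commutator_def
      by (auto simp: quotient_mult_coset[OF I] coset_eq_iff[OF I])
    then show ?thesis
      using commutator_swap[of x] commutator_swap[of _ x] ideal_minus[OF I] by metis
  qed
  then show ?thesis unfolding fully_noncentral_def image_subset_iff by meson
qed

section \<open>Lie ideals modulo a prime ideal\<close>

definition prime_ideal :: "'a::cstar_algebra set \<Rightarrow> bool"
  where "prime_ideal Q \<longleftrightarrow> two_sided_ideal Q \<and> Q \<noteq> UNIV \<and>
    (\<forall>x z. (\<forall>a. x * a * z \<in> Q) \<longrightarrow> x \<in> Q \<or> z \<in> Q)"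

lemma prime_ideal_is_ideal: "prime_ideal Q \<Longrightarrow> two_sided_ideal Q"
  and prime_ideal_proper: "prime_ideal Q \<Longrightarrow> Q \<noteq> UNIV"
  and prime_idealD: "prime_ideal Q \<Longrightarrow> (\<And>a. x * a * z \<in> Q) \<Longrightarrow> x \<in> Q \<or> z \<in> Q"
  unfolding prime_ideal_def by blast+

text \<open>A derivation \<open>D\<close> of a ring satisfies \<open>D\<^sup>2 (ab) = D\<^sup>2(a) b + 2 D(a) D(b) + a D\<^sup>2(b)\<close>. If the
  square of the inner derivation by \<open>x\<close> vanishes modulo \<open>Q\<close>, then so do all \<open>D(a) D(b)\<close>, hence,
  expanding \<open>D(ba)\<close>, all \<open>D(a) b D(a)\<close>.\<close>

lemma prime_ideal_double_commutator:
  assumes Q: "prime_ideal Q" and sq: "\<And>a. commutator x (commutator x a) \<in> Q"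
  shows "commutator x a \<in> Q"
proof -
  note I = prime_ideal_is_ideal[OF Q]
  have prod: "commutator x a * commutator x b \<in> Q" for a b
  proof -
    have "commutator x (commutator x (a * b)) - commutator x (commutator x a) * b
        - a * commutator x (commutator x b) \<in> Q"
      by (intro ideal_diff[OF I] sq ideal_mult_left[OF I] ideal_mult_right[OF I])
    moreover have "commutator x (commutator x (a * b)) - commutator x (commutator x a) * b
        - a * commutator x (commutator x b) = 2 *\<^sub>R (commutator x a * commutator x b)"
      unfolding commutator_def scaleR_2 by (simp add: algebra_simps)
    ultimately have "(1/2) *\<^sub>R 2 *\<^sub>R (commutator x a * commutator x b) \<in> Q"
      by (metis ideal_scaleR[OF I])
    then show ?thesis by simp
  qed
  have "commutator x a * b * commutator x a \<in> Q" for b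
  proof -
    have "commutator x a * commutator x (b * a) - commutator x a * commutator x b * a \<in> Q"
      by (intro ideal_diff[OF I] prod ideal_mult_right[OF I])
    moreover have "commutator x a * commutator x (b * a) - commutator x a * commutator x b * a
        = commutator x a * b * commutator x a"
      unfolding commutator_def by (simp add: algebra_simps)
    ultimately show ?thesis by simp
  qed
  then show ?thesis using prime_idealD[OF Q] by blast
qed

lemma prime_ideal_lie_ideal_commutative:
  assumes Q: "prime_ideal Q" and L: "lie_ideal L"
    and comm: "\<And>x y. x \<in> L \<Longrightarrow> y \<in> L \<Longrightarrow> commutator x y \<in> Q" and x: "x \<in> L"
  shows "commutator a x \<in> Q"
proof -
  note I = prime_ideal_is_ideal[OF Q]
  have "commutator x (commutator x a) \<in> Q" for a
    by (rule comm[OF x lie_ideal_commutator'[OF L x]])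
  then have "commutator x a \<in> Q" by (rule prime_ideal_double_commutator[OF Q])
  then show ?thesis using commutator_swap[of a x] ideal_minus[OF I] by metis
qed

text \<open>Herstein's observation: the two-sided ideal generated by \<open>[L, L]\<close> lies in \<open>L + L\<^sup>2\<close>. One
  multiplication is handled by \<open>[x, y] b = [x, y b] - y [x, b]\<close>, and the other follows because
  \<open>L + L\<^sup>2\<close> is again a Lie ideal. It is stated for an arbitrary subspace \<open>W\<close> containing \<open>L\<close> and
  \<open>L\<^sup>2\<close>, since it serves for centralizers as well.\<close>

lemma ideal_of_lie_commutators:
  assumes L: "lie_ideal L" and W: "csubspace W" and LW: "L \<subseteq> W"
    and LLW: "\<And>x y. x \<in> L \<Longrightarrow> y \<in> L \<Longrightarrow> x * y \<in> W"
    and x: "x \<in> L" and y: "y \<in> L"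
  shows "commutator x y \<in> W" "commutator x y * b \<in> W" "a * commutator x y \<in> W"
    "a * commutator x y * b \<in> W"
proof -
  note bra = lie_ideal_commutator[OF L] and bra' = lie_ideal_commutator'[OF L]
  show t: "commutator x y \<in> W" using bra y LW by blast
  have right: "commutator x y * b \<in> W" for b
  proof -
    have "commutator x y * b = commutator x (y * b) - y * commutator x b"
      unfolding commutator_def by (simp add: algebra_simps)
    also have "\<dots> \<in> W"
      by (intro complex_vector.subspace_diff[OF W] LLW y bra' x subsetD[OF LW])
    finally show ?thesis .
  qed
  then show "commutator x y * b \<in> W" .
  have twist: "commutator a (commutator x y * b) \<in> W" for a b
  proof -
    have "commutator a (commutator x y * b) = commutator a (commutator x (y * b))
        - (commutator a y * commutator x b + y * commutator a (commutator x b))"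
      unfolding commutator_def by (simp add: algebra_simps)
    also have "\<dots> \<in> W"
      by (intro complex_vector.subspace_diff[OF W] complex_vector.subspace_add[OF W] LLW y bra
          bra' x subsetD[OF LW])
    finally show ?thesis .
  qed
  have "a * commutator x y = commutator a (commutator x y) + commutator x y * a"
    unfolding commutator_def by (simp add: algebra_simps)
  also have "\<dots> \<in> W"
    by (intro complex_vector.subspace_add[OF W] right subsetD[OF LW] bra y)
  finally show "a * commutator x y \<in> W" .
  have "a * commutator x y * b = commutator a (commutator x y * b) + commutator x y * (b * a)"
    unfolding commutator_def by (simp add: algebra_simps)
  also have "\<dots> \<in> W"
    by (intro complex_vector.subspace_add[OF W] right twist)
  finally show "a * commutator x y * b \<in> W" .
qed

text \<open>The centralizer of \<open>x\<close> modulo \<open>Q\<close> contains \<open>K\<close> and \<open>K\<^sup>2\<close>, hence \<open>t b\<close> for each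
  \<open>t\<close> in \<open>[K, K]\<close>. Some such \<open>t\<close> is not in \<open>Q\<close>, and \<open>[t b r, x] = t b [r, x] + [t b, x] r\<close>.\<close>

lemma prime_ideal_centralizer_of_lie_ideal:
  assumes Q: "prime_ideal Q" and K: "lie_ideal K"
    and noncentral: "k \<in> K" "commutator c k \<notin> Q"
    and x: "\<And>k. k \<in> K \<Longrightarrow> commutator k x \<in> Q"
  shows "commutator r x \<in> Q"
proof -
  note I = prime_ideal_is_ideal[OF Q]
  obtain k l where kl: "k \<in> K" "l \<in> K" "commutator k l \<notin> Q"
    using prime_ideal_lie_ideal_commutative[OF Q K] noncentral by blast
  define W where "W = {v. commutator v x \<in> Q}"
  have W: "csubspace W"
    unfolding W_def complex_vector.subspace_def
    by (simp add: commutator_add_left commutator_scaleC_left ideal_0[OF I] ideal_add[OF I]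
        ideal_scaleC[OF I])
  have prodW: "p * q \<in> W" if "p \<in> K" "q \<in> K" for p q
  proof -
    have "commutator (p * q) x = p * commutator q x + commutator p x * q"
      unfolding commutator_def by (simp add: algebra_simps)
    also have "\<dots> \<in> Q"
      by (intro ideal_add[OF I] ideal_mult_left[OF I] ideal_mult_right[OF I] x that)
    finally show ?thesis unfolding W_def by simp
  qed
  have KW: "K \<subseteq> W" using x unfolding W_def by blast
  have "commutator k l * b * commutator r x \<in> Q" for b
  proof -
    have "commutator (commutator k l * b) x \<in> Q" for b
      using ideal_of_lie_commutators(2)[OF K W KW prodW kl(1,2)] unfolding W_def by simp
    then have "commutator (commutator k l * (b * r)) x
        - commutator (commutator k l * b) x * r \<in> Q"
      by (intro ideal_diff[OF I] ideal_mult_right[OF I])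
    moreover have "commutator (commutator k l * (b * r)) x
        - commutator (commutator k l * b) x * r = commutator k l * b * commutator r x"
      unfolding commutator_def by (simp add: algebra_simps)
    ultimately show ?thesis by simp
  qed
  then show ?thesis using prime_idealD[OF Q] kl(3) by blast
qed

text \<open>If \<open>c = [u, w]\<close> is central modulo \<open>Q\<close>, then centrality of \<open>[[u, w a], w]\<close> and of
  \<open>[[u, a], w]\<close> gives \<open>c [[a, w], w] \<in> Q\<close>. A central element outside \<open>Q\<close> can be cancelled, so
  either \<open>c \<in> Q\<close> or \<open>w\<close> is central modulo \<open>Q\<close>, which also gives \<open>c \<in> Q\<close>. So \<open>[K\<^sub>1, K\<^sub>2] \<subseteq> Q\<close>, and the
  centralizer of a noncentral Lie ideal is the centre.\<close>

lemma prime_ideal_lie_ideals: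
  assumes Q: "prime_ideal Q" and K: "lie_ideal K\<^sub>1" "lie_ideal K\<^sub>2"
    and central: "\<And>a x y. x \<in> K\<^sub>1 \<Longrightarrow> y \<in> K\<^sub>2 \<Longrightarrow> commutator a (commutator x y) \<in> Q"
  shows "(\<forall>x\<in>K\<^sub>1. \<forall>a. commutator a x \<in> Q) \<or> (\<forall>x\<in>K\<^sub>2. \<forall>a. commutator a x \<in> Q)"
proof -
  note I = prime_ideal_is_ideal[OF Q]
  have comm: "commutator u w \<in> Q" if u: "u \<in> K\<^sub>1" and w: "w \<in> K\<^sub>2" for u w
  proof (rule ccontr)
    let ?c = "commutator u w"
    assume c: "?c \<notin> Q"
    note bra = lie_ideal_commutator'[OF K(1) u]
    have "commutator w (commutator w a) \<in> Q" for a
    proof -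
      have cw: "commutator ?c w \<in> Q"
        using central[OF u w] commutator_swap[of ?c w] ideal_minus[OF I] by metis
      have cQ: "?c * commutator w (commutator w a) \<in> Q" for a
      proof -
        have "commutator w (commutator (commutator u (w * a)) w)
            - w * commutator w (commutator (commutator u a) w)
            - commutator w ?c * commutator a w - commutator w (commutator ?c w * a) \<in> Q"
          by (intro ideal_diff[OF I] central bra u w ideal_mult_left[OF I] ideal_mult_right[OF I]
              ideal_commutator[OF I] cw)
        \<comment> \<open>Here \<open>[u, w a] = c a + w [u, a]\<close> is bracketed with \<open>w\<close> twice.\<close>
        moreover have "commutator w (commutator (commutator u (w * a)) w)
            - w * commutator w (commutator (commutator u a) w)
            - commutator w ?c * commutator a w - commutator w (commutator ?c w * a)
            = - (?c * commutator w (commutator w a))"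
          unfolding commutator_def by (simp add: algebra_simps)
        ultimately show ?thesis using ideal_minus[OF I] by fastforce
      qed
      have "?c * b * commutator w (commutator w a) \<in> Q" for b
      proof -
        have "b * (?c * commutator w (commutator w a))
            - commutator b ?c * commutator w (commutator w a) \<in> Q"
          by (intro ideal_diff[OF I] cQ central u w ideal_mult_left[OF I] ideal_mult_right[OF I])
        then show ?thesis unfolding commutator_def[of b] by (simp add: algebra_simps)
      qed
      then show ?thesis using prime_idealD[OF Q] c by blast
    qed
    then have "commutator w u \<in> Q" by (rule prime_ideal_double_commutator[OF Q])
    then show False using c commutator_swap[of u w] ideal_minus[OF I] by metis
  qed
  show ?thesis
  proof (rule disjCI)
    assume "\<not> (\<forall>x\<in>K\<^sub>2. \<forall>a. commutator a x \<in> Q)"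
    then obtain k c where k: "k \<in> K\<^sub>2" "commutator c k \<notin> Q" by blast
    have "commutator k' x \<in> Q" if "x \<in> K\<^sub>1" "k' \<in> K\<^sub>2" for x k'
      using comm[OF that] commutator_swap[of k' x] ideal_minus[OF I] by metis
    then show "\<forall>x\<in>K\<^sub>1. \<forall>a. commutator a x \<in> Q"
      using prime_ideal_centralizer_of_lie_ideal[OF Q K(2) k] by blast
  qed
qed

section \<open>Adjoining a unit to a Banach algebra\<close>

text \<open>The sum norm makes this a Banach algebra with a unit of norm one. It need not satisfy the
  \<open>C\<^sup>*\<close>-identity, and so only power boundedness, not contractivity, is carried over from the
  algebra to its unitization.\<close>

datatype 'a unitization = Unitization (vector_part: 'a) (scalar_part: real)

instantiation unitization :: (real_algebra) real_algebra_1
begin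

definition zero_unitization :: "'a unitization"
  where "0 = Unitization 0 0"
definition one_unitization :: "'a unitization"
  where "1 = Unitization 0 1"
definition plus_unitization :: "'a unitization \<Rightarrow> 'a unitization \<Rightarrow> 'a unitization"
  where "x + y = Unitization (vector_part x + vector_part y) (scalar_part x + scalar_part y)"
definition minus_unitization :: "'a unitization \<Rightarrow> 'a unitization \<Rightarrow> 'a unitization"
  where "x - y = Unitization (vector_part x - vector_part y) (scalar_part x - scalar_part y)"
definition uminus_unitization :: "'a unitization \<Rightarrow> 'a unitization"
  where "- x = Unitization (- vector_part x) (- scalar_part x)"
definition times_unitization :: "'a unitization \<Rightarrow> 'a unitization \<Rightarrow> 'a unitization"
  where "x * y = Unitization
    (vector_part x * vector_part y + scalar_part y *\<^sub>R vector_part x + scalar_part x *\<^sub>R vector_part y)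
    (scalar_part x * scalar_part y)"
definition scaleR_unitization :: "real \<Rightarrow> 'a unitization \<Rightarrow> 'a unitization"
  where "r *\<^sub>R x = Unitization (r *\<^sub>R vector_part x) (r * scalar_part x)"

lemmas unitization_defs = zero_unitization_def one_unitization_def plus_unitization_def
  minus_unitization_def uminus_unitization_def times_unitization_def scaleR_unitization_def

instance
proof
  fix x y z :: "'a unitization" and r s :: real
  show "x + y + z = x + (y + z)" "x + y = y + x" "0 + x = x" "- x + x = 0" "x - y = x + - y"
    "r *\<^sub>R (x + y) = r *\<^sub>R x + r *\<^sub>R y" "(r + s) *\<^sub>R x = r *\<^sub>R x + s *\<^sub>R x"
    "r *\<^sub>R s *\<^sub>R x = (r * s) *\<^sub>R x" "1 *\<^sub>R x = x"
    "1 * x = x" "x * 1 = x" "(0 :: 'a unitization) \<noteq> 1"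
    by (simp_all add: unitization_defs algebra_simps)
  show "x * y * z = x * (y * z)" "(x + y) * z = x * z + y * z" "x * (y + z) = x * y + x * z"
    "r *\<^sub>R x * y = r *\<^sub>R (x * y)" "x * r *\<^sub>R y = r *\<^sub>R (x * y)"
    by (simp_all add: unitization_defs algebra_simps)
qed

end

instantiation unitization :: (real_normed_algebra) real_normed_algebra_1
begin

definition norm_unitization :: "'a unitization \<Rightarrow> real"
  where "norm x = norm (vector_part x) + \<bar>scalar_part x\<bar>"
definition sgn_unitization :: "'a unitization \<Rightarrow> 'a unitization"
  where "sgn_unitization x = x /\<^sub>R norm x"
definition dist_unitization :: "'a unitization \<Rightarrow> 'a unitization \<Rightarrow> real"
  where "dist_unitization x y = norm (x - y)"
definition uniformity_unitization :: "('a unitization \<times> 'a unitization) filter"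
  where "uniformity_unitization = (INF e\<in>{0<..}. principal {(x :: 'a unitization, y). dist x y < e})"
definition open_unitization :: "'a unitization set \<Rightarrow> bool"
  where "open_unitization U \<longleftrightarrow> (\<forall>x\<in>U. eventually (\<lambda>(x', y). x' = x \<longrightarrow> y \<in> U) uniformity)"

instance
proof
  fix x y :: "'a unitization" and r :: real
  show "dist x y = norm (x - y)" by (rule dist_unitization_def)
  show "sgn x = x /\<^sub>R norm x" by (rule sgn_unitization_def)
  show "uniformity = (INF e\<in>{0<..}. principal {(x :: 'a unitization, y). dist x y < e})"
    by (rule uniformity_unitization_def)
  show "open U \<longleftrightarrow> (\<forall>x\<in>U. eventually (\<lambda>(x', y). x' = x \<longrightarrow> y \<in> U) uniformity)"
    for U :: "'a unitization set"
    by (rule open_unitization_def)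
  show "norm x = 0 \<longleftrightarrow> x = 0"
    by (cases x) (auto simp: norm_unitization_def zero_unitization_def add_nonneg_eq_0_iff)
  show "norm (x + y) \<le> norm x + norm y"
    using norm_triangle_ineq[of "vector_part x" "vector_part y"]
    by (simp add: norm_unitization_def plus_unitization_def)
  show "norm (r *\<^sub>R x) = \<bar>r\<bar> * norm x"
    by (simp add: norm_unitization_def scaleR_unitization_def abs_mult algebra_simps)
  show "norm (1 :: 'a unitization) = 1"
    by (simp add: norm_unitization_def one_unitization_def)
  show "norm (x * y) \<le> norm x * norm y"
  proof -
    have "norm (vector_part (x * y)) \<le> norm (vector_part x) * norm (vector_part y)
        + \<bar>scalar_part y\<bar> * norm (vector_part x) + \<bar>scalar_part x\<bar> * norm (vector_part y)"
      unfolding times_unitization_def unitization.sel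
      by (intro order_trans[OF norm_triangle_ineq] add_mono) (simp_all add: norm_mult_ineq)
    then show ?thesis
      by (simp add: norm_unitization_def times_unitization_def abs_mult algebra_simps)
  qed
qed

end

lemma Cauchy_nonexpansive:
  fixes f :: "'b::metric_space \<Rightarrow> 'c::metric_space"
  assumes X: "Cauchy X" and f: "\<And>x y. dist (f x) (f y) \<le> dist x y"
  shows "Cauchy (\<lambda>n. f (X n))"
  using X f unfolding Cauchy_def by (meson le_less_trans)

instance unitization :: ("{real_normed_algebra, banach}") banach
proof
  fix X :: "nat \<Rightarrow> 'a unitization"
  assume X: "Cauchy X"
  have "Cauchy (\<lambda>n. vector_part (X n))" "Cauchy (\<lambda>n. scalar_part (X n))"
    by (rule Cauchy_nonexpansive[OF X];
        simp add: dist_norm norm_unitization_def minus_unitization_def)+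
  then obtain a r where lim: "(\<lambda>n. vector_part (X n)) \<longlonglongrightarrow> a" "(\<lambda>n. scalar_part (X n)) \<longlonglongrightarrow> r"
    using Cauchy_convergent unfolding convergent_def by metis
  have "(\<lambda>n. dist (vector_part (X n)) a + dist (scalar_part (X n)) r) \<longlonglongrightarrow> 0 + 0"
    by (intro tendsto_add lim[THEN tendsto_dist_iff[THEN iffD1]])
  then have "(\<lambda>n. dist (X n) (Unitization a r)) \<longlonglongrightarrow> 0"
    by (simp add: dist_norm norm_unitization_def minus_unitization_def)
  then have "X \<longlonglongrightarrow> Unitization a r" by (rule tendsto_dist_iff[THEN iffD2])
  then show "convergent X" unfolding convergent_def by blast
qed

lemma scalar_part_power: "scalar_part (x ^ n) = scalar_part x ^ n"
  by (induction n) (simp_all add: one_unitization_def times_unitization_def)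

lemma tendsto_scalar_part:
  assumes "X \<longlonglongrightarrow> x"
  shows "(\<lambda>n. scalar_part (X n)) \<longlonglongrightarrow> scalar_part x"
proof (rule tendsto_dist_iff[THEN iffD2], rule real_tendsto_sandwich[OF _ _ tendsto_const])
  show "(\<lambda>n. dist (X n) x) \<longlonglongrightarrow> 0" using assms by (rule tendsto_dist_iff[THEN iffD1])
qed (simp_all add: dist_norm norm_unitization_def minus_unitization_def)

section \<open>Power factorization for power-bounded elements\<close>

lemma inverse_one_minus:
  fixes x :: "'b::{real_normed_algebra_1, banach}"
  assumes "norm x \<le> 1/2"
  obtains g where "(1 - x) * g = 1" "g * (1 - x) = 1" "norm g \<le> 2"
proof -
  define g where "g = (\<Sum>n. x ^ n)"
  have sum: "summable (\<lambda>n. x ^ n)"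
    using assms by (intro complete_algebra_summable_geometric) simp
  have "g = 1 + (\<Sum>n. x ^ Suc n)"
    unfolding g_def using suminf_split_initial_segment[OF sum, of 1] by simp
  moreover have "(\<Sum>n. x ^ Suc n) = x * g" "(\<Sum>n. x ^ Suc n) = g * x"
    unfolding g_def using suminf_mult[OF sum, of x] suminf_mult2[OF sum, of x]
    by (simp_all add: power_commutes)
  ultimately have g: "g = 1 + x * g" "g = 1 + g * x" by simp_all
  have "norm g \<le> 1 + norm x * norm g"
    using g(1) norm_triangle_ineq[of 1 "x * g"] norm_mult_ineq[of x g] by simp
  also have "\<dots> \<le> 1 + 1/2 * norm g" by (intro add_left_mono mult_right_mono assms) simp
  finally have "norm g \<le> 2" by simp
  moreover have "(1 - x) * g = 1" using g(1) by (simp add: algebra_simps)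
  moreover have "g * (1 - x) = 1" using g(2) by (simp add: algebra_simps)
  ultimately show thesis using that by blast
qed

text \<open>The means \<open>M = (1 + w + \<dots> + w\<^sup>m\<^sup>-\<^sup>1) / m\<close> are bounded, and \<open>(1 - w) M = (1 - w\<^sup>m) / m\<close>
  becomes small, so that \<open>1 - M\<close> acts on \<open>1 - w\<close> almost as a unit, while it is itself a multiple of
  \<open>1 - w\<close>, and so has scalar part zero in the application to the unitization.\<close>

lemma cesaro_means:
  fixes w :: "'b::real_normed_algebra_1"
  assumes bound: "\<And>j. norm (w ^ j) \<le> K" and e: "e > 0"
  obtains M N where "norm M \<le> K" "norm ((1 - w) * M) \<le> e" "1 - M = N * (1 - w)"
    "\<And>x. x * w = w * x \<Longrightarrow> x * M = M * x"
proof -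
  obtain m :: nat where m: "m > 0" "(1 + K) / e \<le> m"
    using real_arch_simple[of "max 1 ((1 + K) / e)"] by (auto simp: max_def split: if_splits)
  define S where "S = (\<lambda>j. \<Sum>i<j. w ^ i)"
  have S: "(1 - w) * S j = 1 - w ^ j" "S j * (1 - w) = 1 - w ^ j" for j
  proof -
    show 1: "(1 - w) * S j = 1 - w ^ j"
      unfolding S_def by (induction j) (simp_all add: distrib_left left_diff_distrib)
    have "S j * w = w * S j"
      unfolding S_def by (simp add: sum_distrib_left sum_distrib_right power_commutes)
    then have "S j * (1 - w) = (1 - w) * S j"
      by (simp add: left_diff_distrib right_diff_distrib)
    then show "S j * (1 - w) = 1 - w ^ j" using 1 by simp
  qed
  define M where "M = (1 / real m) *\<^sub>R S m"
  define N where "N = (1 / real m) *\<^sub>R (\<Sum>j<m. S j)"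
  have "norm (S m) \<le> real m * K"
    unfolding S_def using sum_norm_le[of "{..<m}" "\<lambda>i. w ^ i" "\<lambda>_. K"] bound by simp
  then have "norm M \<le> K" using m(1) unfolding M_def by (simp add: field_simps)
  moreover have "norm ((1 - w) * M) \<le> e"
  proof -
    have "norm (1 - w ^ m) \<le> 1 + K" using norm_triangle_ineq4[of 1 "w ^ m"] bound[of m] by simp
    then have "norm ((1 - w) * M) \<le> (1 + K) / m"
      unfolding M_def using m(1) by (simp add: S divide_right_mono)
    also have "\<dots> \<le> e" using m e by (simp add: field_simps)
    finally show ?thesis .
  qed
  moreover have "1 - M = N * (1 - w)"
  proof -
    have "N * (1 - w) = (1 / real m) *\<^sub>R (\<Sum>j<m. 1 - w ^ j)"
      unfolding N_def by (simp add: sum_distrib_right S)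
    also have "\<dots> = 1 - M"
      unfolding M_def S_def using m(1)
      by (simp add: sum_subtractf scaleR_diff_right sum_constant_scaleR del: sum_constant)
    finally show ?thesis by simp
  qed
  moreover have "x * M = M * x" if "x * w = w * x" for x
    unfolding M_def S_def
    by (simp add: sum_distrib_left sum_distrib_right power_commuting_commutes[OF that[symmetric]])
  ultimately show thesis using that by blast
qed

lemma norm_mult_power_minus_1_le:
  fixes d g :: "'b::real_normed_algebra_1"
  assumes g: "norm g \<le> 2" and e: "norm (d * (g - 1)) \<le> e"
  shows "norm (d * (g ^ n - 1)) \<le> 2 ^ n * e"
proof -
  have "norm (d * (g ^ n - 1)) \<le> (2 ^ n - 1) * e"
  proof (induction n)
    case (Suc n)
    have "d * (g ^ Suc n - 1) = d * (g ^ n - 1) * g + d * (g - 1)"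
      by (simp add: algebra_simps power_commutes)
    then have "norm (d * (g ^ Suc n - 1)) \<le> norm (d * (g ^ n - 1) * g) + norm (d * (g - 1))"
      using norm_triangle_ineq by metis
    also have "\<dots> \<le> norm (d * (g ^ n - 1)) * norm g + norm (d * (g - 1))"
      by (intro add_right_mono norm_mult_ineq)
    also have "\<dots> \<le> (2 ^ n - 1) * e * 2 + e"
      using order_trans[OF norm_ge_zero Suc] by (intro add_mono mult_mono Suc g e) simp_all
    also have "\<dots> = (2 ^ Suc n - 1) * e" by (simp add: algebra_simps)
    finally show ?case .
  qed simp
  also have "\<dots> \<le> 2 ^ n * e"
    using order_trans[OF norm_ge_zero e] by (intro mult_right_mono) simp_all
  finally show ?thesis .
qed

lemma commutes_inverse:
  fixes f :: "'b::monoid_mult"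
  assumes "f * x = x * f" "f * h = 1" "h * f = 1"
  shows "h * x = x * h"
proof -
  have "h * x = h * (x * f) * h" using assms(2) by (simp add: mult.assoc)
  also have "\<dots> = h * f * x * h" unfolding assms(1)[symmetric] by (simp add: mult.assoc)
  finally show ?thesis using assms(3) by simp
qed

lemma power_mult_commuting:
  fixes x :: "'b::monoid_mult"
  assumes "x * y = y * x"
  shows "(x * y) ^ n = x ^ n * y ^ n"
proof (induction n)
  case (Suc n)
  have "(x * y) ^ Suc n = x * (y * x ^ n) * y ^ n" using Suc by (simp add: mult.assoc)
  then show ?case
    unfolding power_commuting_commutes[OF assms, symmetric] by (simp add: mult.assoc power_commutes)
qed simp

text \<open>Replacing \<open>y\<close> by \<open>y (1 - M / (2K))\<close> for a mean \<open>M\<close> of powers of \<open>w\<close> shrinks the scalar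
  term of \<open>y\<close> by a fixed factor and changes \<open>y\<close> by little more than the size \<open>a\<close> of that term,
  because \<open>M\<close> almost annihilates \<open>1 - w\<close>. The inverse \<open>g\<close> may double in norm, but for the same
  reason the elements \<open>(1 - w) g\<^sup>n\<close> hardly change.\<close>

lemma factorization_step:
  fixes w :: "'b::{real_normed_algebra_1, banach}"
  assumes bound: "\<And>j. norm (w ^ j) \<le> K"
    and y: "y = a *\<^sub>R 1 + p * (1 - w)" and gy: "g * y = 1" and gw: "g * w = w * g"
    and a: "a \<ge> 0" and e: "e > 0"
  obtains y' g' p' where "y' = ((1 - 1 / (2 * K)) * a) *\<^sub>R 1 + p' * (1 - w)" "g' * y' = 1"
    "g' * w = w * g'" "norm g' \<le> 2 * norm g" "norm (y' - y) \<le> a + norm p * e"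
    "\<And>n. norm ((1 - w) * (g' ^ n - g ^ n)) \<le> 2 ^ n * e * norm g ^ n"
proof -
  have K: "K \<ge> 1" using bound[of 0] by simp
  obtain M N where M: "norm M \<le> K" "norm ((1 - w) * M) \<le> e" "1 - M = N * (1 - w)"
    and Mcomm: "\<And>x. x * w = w * x \<Longrightarrow> x * M = M * x"
    using cesaro_means[OF bound e] by blast
  define m where "m = (1 / (2 * K)) *\<^sub>R M"
  have m: "norm m \<le> 1/2" using M(1) K unfolding m_def by (simp add: field_simps)
  have dm: "norm ((1 - w) * m) \<le> e / 2"
  proof -
    have "norm ((1 - w) * m) = norm ((1 - w) * M) / (2 * K)" unfolding m_def using K by simp
    also have "\<dots> \<le> e / 2" using M(2) K e by (intro frac_le) simp_all
    finally show ?thesis .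
  qed
  have mcomm: "x * m = m * x" if "x * w = w * x" for x
    unfolding m_def using Mcomm[OF that] by simp
  obtain h where h: "(1 - m) * h = 1" "h * (1 - m) = 1" "norm h \<le> 2"
    using inverse_one_minus[OF m] by blast
  have hw: "h * w = w * h"
    by (rule commutes_inverse[OF _ h(1,2)]) (simp add: left_diff_distrib right_diff_distrib mcomm)
  have hg: "h * g = g * h"
    by (rule commutes_inverse[OF _ h(1,2)])
      (simp add: left_diff_distrib right_diff_distrib mcomm[OF gw])
  define p' where "p' = p * (1 - m) + (a / (2 * K)) *\<^sub>R N"
  have wm: "(1 - w) * (1 - m) = (1 - m) * (1 - w)"
    using mcomm[of w] by (simp add: algebra_simps)
  show thesis
  proof (rule that[of "y * (1 - m)" p' "h * g"])
    have "y * (1 - m) = a *\<^sub>R (1 - m) + p * (1 - m) * (1 - w)"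
      unfolding y by (simp add: distrib_right mult.assoc wm)
    also have "1 - m = (1 - 1 / (2 * K)) *\<^sub>R 1 + (1 / (2 * K)) *\<^sub>R (1 - M)"
      unfolding m_def by (simp add: algebra_simps)
    finally have "y * (1 - m) = a *\<^sub>R ((1 - 1 / (2 * K)) *\<^sub>R 1 + (1 / (2 * K)) *\<^sub>R (1 - M))
        + p * (1 - m) * (1 - w)"
      by (simp add: m_def algebra_simps)
    then show "y * (1 - m) = ((1 - 1 / (2 * K)) * a) *\<^sub>R 1 + p' * (1 - w)"
      unfolding p'_def M(3) by (simp add: distrib_right scaleR_add_right mult.commute)
    have "h * g * (y * (1 - m)) = h * (g * y) * (1 - m)" by (simp add: mult.assoc)
    then show "h * g * (y * (1 - m)) = 1" using gy h(2) by simp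
    have "h * g * w = h * w * g" using gw by (simp add: mult.assoc)
    then show "h * g * w = w * (h * g)" using hw by (simp add: mult.assoc)
    show "norm (h * g) \<le> 2 * norm g"
      using norm_mult_ineq[of h g] mult_right_mono[OF h(3) norm_ge_zero[of g]] by linarith
    have "y * (1 - m) - y = - (a *\<^sub>R m + p * ((1 - w) * m))"
      unfolding y by (simp add: algebra_simps)
    then have "norm (y * (1 - m) - y) \<le> norm (a *\<^sub>R m) + norm (p * ((1 - w) * m))"
      using norm_triangle_ineq by (metis norm_minus_cancel)
    also have "\<dots> \<le> a * norm m + norm p * norm ((1 - w) * m)"
      using a norm_mult_ineq[of p] by simp
    also have "\<dots> \<le> a * 1 + norm p * e"
      using m dm e a by (intro add_mono mult_left_mono) simp_all
    finally show "norm (y * (1 - m) - y) \<le> a + norm p * e" by simp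
    fix n
    have "h - 1 = m * h" using h(1) by (simp add: algebra_simps)
    then have "norm ((1 - w) * (h - 1)) = norm ((1 - w) * m * h)" by (simp add: mult.assoc)
    also have "\<dots> \<le> norm ((1 - w) * m) * norm h" by (rule norm_mult_ineq)
    also have "\<dots> \<le> e / 2 * 2" using e by (intro mult_mono dm h(3)) simp_all
    finally have h_e: "norm ((1 - w) * (h - 1)) \<le> e" by simp
    have "(1 - w) * ((h * g) ^ n - g ^ n) = (1 - w) * (h ^ n - 1) * g ^ n"
      unfolding power_mult_commuting[OF hg] by (simp add: algebra_simps)
    also have "norm \<dots> \<le> norm ((1 - w) * (h ^ n - 1)) * norm (g ^ n)" by (rule norm_mult_ineq)
    also have "\<dots> \<le> 2 ^ n * e * norm g ^ n"
      using e by (intro mult_mono norm_mult_power_minus_1_le h(3) h_e norm_power_ineq) simp_all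
    finally show "norm ((1 - w) * ((h * g) ^ n - g ^ n)) \<le> 2 ^ n * e * norm g ^ n" .
  qed
qed

lemma convergent_of_summable_increments:
  fixes X :: "nat \<Rightarrow> 'b::banach"
  assumes "\<And>k. k \<ge> N \<Longrightarrow> norm (X (Suc k) - X k) \<le> b k" "summable b"
  obtains x where "X \<longlonglongrightarrow> x"
proof -
  have "summable (\<lambda>k. X (Suc k) - X k)"
    by (rule summable_comparison_test[OF _ assms(2)]) (use assms(1) in auto)
  then have "convergent (\<lambda>n. X n - X 0)"
    unfolding summable_iff_convergent sum_lessThan_telescope .
  then obtain x where "(\<lambda>n. X n - X 0) \<longlonglongrightarrow> x" unfolding convergent_def by blast
  then have "(\<lambda>n. (X n - X 0) + X 0) \<longlonglongrightarrow> x + X 0" by (intro tendsto_add tendsto_const)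
  then show thesis using that by simp
qed

text \<open>This is Cohen's factorization argument, in the form of Allan and Sinclair that gives one
  base \<open>y\<close> for all exponents. It produces invertible elements \<open>y\<^sub>k = c\<^sup>k + p\<^sub>k (1 - w)\<close> that
  converge although their inverses \<open>g\<^sub>k\<close> do not; but \<open>(1 - w) g\<^sub>k\<^sup>n\<close> converges for each \<open>n\<close>, and
  \<open>(1 - w) g\<^sub>k\<^sup>n y\<^sub>k\<^sup>n = 1 - w\<close>.\<close>

lemma power_factorization:
  fixes w :: "'b::{real_normed_algebra_1, banach}"
  assumes bound: "\<And>j. norm (w ^ j) \<le> K"
  obtains y p where "(\<lambda>k. p k * (1 - w)) \<longlonglongrightarrow> y" "\<And>n. \<exists>z. 1 - w = z * y ^ n"
proof -
  define d where "d = 1 - w"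
  define c where "c = 1 - 1 / (2 * K)"
  have "K \<ge> 1" using bound[of 0] by simp
  then have c: "0 < c" "c < 1" unfolding c_def by (simp_all add: field_simps)
  define P where "P = (\<lambda>k (y, g, p). y = c ^ k *\<^sub>R 1 + p * d \<and> g * y = 1 \<and> g * w = w * g \<and>
    norm g \<le> 2 ^ k)"
  define R where "R = (\<lambda>k (y :: 'b, g, p :: 'b) (y', g', p' :: 'b). norm (y' - y) \<le> 2 * c ^ k \<and>
    (\<forall>n\<le>k. norm (d * g' ^ n - d * g ^ n) \<le> 2 ^ n * (1/2) ^ k))"
  have "\<exists>f. \<forall>k. P k (f k) \<and> R k (f k) (f (Suc k))"
  proof (rule dependent_nat_choice)
    show "\<exists>x. P 0 x" unfolding P_def by (rule exI[of _ "(1, 1, 0)"]) simp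
  next
    fix x k assume "P k x"
    then obtain y g p where x: "x = (y, g, p)" and P: "y = c ^ k *\<^sub>R 1 + p * d" "g * y = 1"
      "g * w = w * g" "norm g \<le> 2 ^ k" unfolding P_def by (cases x) auto
    \<comment> \<open>The first bound makes \<open>y\<^sub>k\<close> converge. The second beats \<open>norm g ^ n \<le> 2 ^ (k * n)\<close> for all
      \<open>n \<le> k\<close>, hence eventually for each fixed \<open>n\<close>.\<close>
    define e where "e = min (c ^ k / (1 + norm p)) ((1/2) ^ k / 2 ^ (k * k))"
    have p1: "1 + norm p > 0" using norm_ge_zero[of p] by linarith
    have e: "e > 0" unfolding e_def using c p1 by simp
    have ck: "c ^ k \<ge> 0" using c by simp
    obtain y' g' p' where step: "y' = ((1 - 1 / (2 * K)) * c ^ k) *\<^sub>R 1 + p' * (1 - w)"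
      "g' * y' = 1" "g' * w = w * g'" "norm g' \<le> 2 * norm g"
      "norm (y' - y) \<le> c ^ k + norm p * e"
      "\<And>n. norm ((1 - w) * (g' ^ n - g ^ n)) \<le> 2 ^ n * e * norm g ^ n"
      by (rule factorization_step[OF bound P(1)[unfolded d_def] P(2,3) ck e]) (rule that)
    have "norm p * e \<le> (1 + norm p) * (c ^ k / (1 + norm p))"
      using e p1 by (intro mult_mono) (simp_all add: e_def)
    then have y': "norm (y' - y) \<le> 2 * c ^ k" using step(5) p1 by simp
    have g': "norm (d * g' ^ n - d * g ^ n) \<le> 2 ^ n * (1/2) ^ k" if n: "n \<le> k" for n
    proof -
      have "norm g ^ n \<le> (2 ^ k) ^ n" by (intro power_mono P(4)) simp
      also have "\<dots> \<le> 2 ^ (k * k)" unfolding power_mult[symmetric] using n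
        by (intro power_increasing) simp_all
      finally have "e * norm g ^ n \<le> (1/2) ^ k / 2 ^ (k * k) * 2 ^ (k * k)"
        by (intro mult_mono) (simp_all add: e_def)
      then have "2 ^ n * e * norm g ^ n \<le> 2 ^ n * (1/2) ^ k" by (simp add: mult.assoc)
      with step(6)[of n] show ?thesis unfolding d_def right_diff_distrib by (rule order_trans)
    qed
    show "\<exists>x'. P (Suc k) x' \<and> R k x x'"
      unfolding P_def R_def x
      by (rule exI[of _ "(y', g', p')"])
        (use step(1-4) P(4) y' g' in \<open>simp add: c_def d_def\<close>)
  qed
  then obtain f where f: "\<And>k. P k (f k)" "\<And>k. R k (f k) (f (Suc k))" by blast
  define y where "y = (\<lambda>k. fst (f k))"
  define g where "g = (\<lambda>k. fst (snd (f k)))"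
  define p where "p = (\<lambda>k. snd (snd (f k)))"
  have P: "y k = c ^ k *\<^sub>R 1 + p k * d" "g k * y k = 1" for k
    using f(1)[of k] unfolding P_def y_def g_def p_def case_prod_beta by blast+
  have R: "norm (y (Suc k) - y k) \<le> 2 * c ^ k"
    "n \<le> k \<Longrightarrow> norm (d * g (Suc k) ^ n - d * g k ^ n) \<le> 2 ^ n * (1/2) ^ k" for k n
    using f(2)[of k] unfolding R_def y_def g_def by (simp_all add: case_prod_beta)
  have geo: "summable (\<lambda>k. 2 * c ^ k)" "summable (\<lambda>k. 2 ^ n * (1/2 :: real) ^ k)" for n
    using c by (intro summable_mult summable_geometric; simp)+
  obtain y0 where y0: "y \<longlonglongrightarrow> y0"
    using convergent_of_summable_increments[OF R(1) geo(1)] by blast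
  have "(\<lambda>k. y k - c ^ k *\<^sub>R 1) \<longlonglongrightarrow> y0 - 0 *\<^sub>R 1"
    using c by (intro tendsto_diff y0 tendsto_scaleR LIMSEQ_power_zero tendsto_const) simp
  then have lim: "(\<lambda>k. p k * (1 - w)) \<longlonglongrightarrow> y0" unfolding P(1) d_def by simp
  have "\<exists>z. 1 - w = z * y0 ^ n" for n
  proof -
    obtain z where z: "(\<lambda>k. d * g k ^ n) \<longlonglongrightarrow> z"
      using convergent_of_summable_increments[OF R(2) geo(2)] by blast
    have "(\<lambda>k. d * g k ^ n * y k ^ n) \<longlonglongrightarrow> z * y0 ^ n"
      by (intro tendsto_mult tendsto_power z y0)
    moreover have "d * g k ^ n * y k ^ n = d" for k
      using left_right_inverse_power[OF P(2)] by (simp add: mult.assoc)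
    ultimately show ?thesis unfolding d_def by (auto simp: LIMSEQ_const_iff)
  qed
  then show thesis using that lim by blast
qed

section \<open>Powers outside an ideal of a \<open>C\<^sup>*\<close>-algebra\<close>

lemma norm_star: "norm (star x) = norm (x :: 'a::cstar_algebra)"
proof -
  have le: "norm x \<le> norm (star x)" for x :: 'a
  proof (cases "norm x = 0")
    case False
    have "norm x * norm x \<le> norm (star x) * norm x"
      using norm_mult_ineq[of "star x" x] norm_star_mult_self[of x] by (simp add: power2_eq_square)
    then show ?thesis using False by simp
  qed simp
  show ?thesis using le[of x] le[of "star x"] star_star[of x] by simp
qed

lemma star_scaleR: "star (r *\<^sub>R x) = r *\<^sub>R star (x :: 'a::cstar_algebra)"
  unfolding scaleC_of_real[symmetric] star_scaleC by simp

text \<open>For skew-adjoint \<open>u\<close> the formal element \<open>1 + 2 s\<close> with \<open>s = u / (1 - u)\<close> is the Cayley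
  transform \<open>(1 + u) / (1 - u)\<close>, a unitary, and multiplication by a unitary is isometric.\<close>

lemma cayley_transform_isometric:
  fixes u s x :: "'a::cstar_algebra"
  assumes u: "star u = - u" and s: "s = u + u * s"
  shows "norm (x + 2 *\<^sub>R (s * x)) = norm x"
proof -
  let ?w = "x + 2 *\<^sub>R (s * x)"
  have star_s: "star s = - u - star s * u"
  proof -
    have "star s = star (u + u * s)" using s by simp
    then show ?thesis by (simp add: star_add star_mult u)
  qed
  have 0: "star s + s + 2 *\<^sub>R (star s * s) = 0"
  proof -
    have "star s * s = star s * (u + u * s)" using s by simp
    also have "\<dots> = (star s * u) + (star s * u) * s" by (simp add: algebra_simps)
    also have "star s * u = - u - star s" using star_s by (simp add: algebra_simps)
    also have "(- u - star s) * s = - (u * s) - star s * s" by (simp add: algebra_simps)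
    also have "u * s = s - u" using s by (simp add: algebra_simps)
    finally have "star s * s + star s * s = - star s - s" by (simp add: algebra_simps)
    then show ?thesis by (simp add: scaleR_2)
  qed
  have "star ?w * ?w = star x * x + 2 *\<^sub>R (star x * (star s + s + 2 *\<^sub>R (star s * s)) * x)"
    by (simp add: star_add star_scaleR star_mult algebra_simps)
  then have "(norm ?w)\<^sup>2 = (norm x)\<^sup>2"
    using norm_star_mult_self[of ?w] norm_star_mult_self[of x] by (simp add: 0)
  then show ?thesis by simp
qed

lemma cayley_transform_power_bounded:
  fixes u s :: "'a::cstar_algebra"
  assumes u: "star u = - u" and s: "s = u + u * s"
  shows "norm (Unitization (2 *\<^sub>R s) 1 ^ j) \<le> 3"
proof -
  let ?w = "Unitization (2 *\<^sub>R s) 1"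
  have act: "\<exists>y. ?w ^ j * Unitization x 0 = Unitization y 0 \<and> norm y = norm x" for x
  proof (induction j)
    case (Suc j)
    then obtain y where y: "?w ^ j * Unitization x 0 = Unitization y 0" "norm y = norm x" by blast
    have "?w ^ Suc j * Unitization x 0 = ?w * Unitization y 0"
      using y(1) by (simp add: mult.assoc)
    also have "\<dots> = Unitization (y + 2 *\<^sub>R (s * y)) 0"
      by (simp add: times_unitization_def)
    finally show ?case using cayley_transform_isometric[OF u s, of y] y(2) by auto
  qed simp
  define v where "v = vector_part (?w ^ j)"
  have w: "?w ^ j = Unitization v 1"
    using scalar_part_power[of ?w j] unfolding v_def
    by (metis power_one unitization.collapse unitization.sel(2))
  \<comment> \<open>The isometry is applied to the adjoint of \<open>v\<close>, so that the \<open>C\<^sup>*\<close>-identity bounds \<open>v\<close>.\<close>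
  have "norm (v * star v + star v) = norm (star v)"
    using act[of "star v"] unfolding w by (simp add: times_unitization_def)
  then have "norm (v * star v) \<le> 2 * norm (star v)"
    using norm_triangle_ineq4[of "v * star v + star v" "star v"] by simp
  moreover have "norm (v * star v) = (norm v)\<^sup>2"
    using norm_star_mult_self[of "star v"] by (simp add: star_star norm_star)
  ultimately have "norm v * norm v \<le> 2 * norm v" by (simp add: norm_star power2_eq_square)
  then have "norm v \<le> 2" by (cases "norm v = 0") auto
  then show ?thesis unfolding w norm_unitization_def by simp
qed

lemma skew_adjoint_outside_ideal:
  assumes I: "two_sided_ideal I" "I \<noteq> UNIV"
  obtains u where "star u = - u" "u \<notin> I" "norm u \<le> 1/2"
proof -
  obtain a where a: "a \<notin> I" using I(2) by auto
  have "\<exists>u. star u = - u \<and> u \<notin> I"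
  proof (rule ccontr)
    assume "\<not> ?thesis"
    then have skew: "u \<in> I" if "star u = - u" for u using that by blast
    have minus: "a - star a \<in> I"
      using star_add[of a "- star a"] star_scaleC[of "- 1" "star a"] star_star[of a]
      by (intro skew) simp
    have "\<i> *\<^sub>C (a + star a) \<in> I"
      by (intro skew) (simp add: star_scaleC star_add star_star add.commute)
    then have "(- \<i>) *\<^sub>C \<i> *\<^sub>C (a + star a) \<in> I" by (rule ideal_scaleC[OF I(1)])
    then have "a + star a \<in> I" by (simp add: scaleC_scaleC scaleC_one)
    then have "(1/2) *\<^sub>R ((a - star a) + (a + star a)) \<in> I"
      by (rule ideal_scaleR[OF I(1) ideal_add[OF I(1) minus]])
    moreover have "(1/2) *\<^sub>R ((a - star a) + (a + star a)) = a"
      by (simp add: scaleR_2[symmetric])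
    ultimately show False using a by simp
  qed
  then obtain u where u: "star u = - u" "u \<notin> I" by blast
  define r where "r = 1 / (2 * norm u)"
  have nz: "norm u \<noteq> 0" using u(2) ideal_0[OF I(1)] by auto
  have "u = (1 / r) *\<^sub>R r *\<^sub>R u" using nz unfolding r_def by simp
  then have "r *\<^sub>R u \<notin> I" using u(2) ideal_scaleR[OF I(1)] by metis
  moreover have "star (r *\<^sub>R u) = - (r *\<^sub>R u)" using u(1) by (simp add: star_scaleR)
  moreover have "norm (r *\<^sub>R u) \<le> 1/2" using nz unfolding r_def by simp
  ultimately show thesis using that by blast
qed

text \<open>By \<open>power_factorization\<close> the element \<open>2 s\<close> of the Cayley transform \<open>1 + 2 s\<close> is a multiple of
  every power of one \<open>y\<close>, whereas \<open>s \<in> I\<close> would give \<open>u = s - u s \<in> I\<close>. The limit \<open>y\<close> lies in the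
  algebra because the scalar part is continuous and vanishes on the multiples of \<open>1 - w\<close>. Iterated
  squares stand for powers, since an algebra without a unit has no zeroth power.\<close>

lemma squares_outside_ideal:
  fixes I :: "'a::cstar_algebra set"
  assumes I: "two_sided_ideal I" "I \<noteq> UNIV"
  obtains y where "\<And>k. ((\<lambda>x. x * x) ^^ k) y \<notin> I"
proof -
  obtain u where u: "star u = - u" "u \<notin> I" "norm u \<le> 1/2"
    using skew_adjoint_outside_ideal[OF I] by blast
  obtain g where g: "(1 - Unitization u 0) * g = 1"
    using inverse_one_minus[of "Unitization u 0"] u(3) by (auto simp: norm_unitization_def)
  define s where "s = vector_part g"
  have "scalar_part g = 1" "s = u + u * s"
    using g unfolding s_def
    by (auto simp: unitization_defs algebra_simps)
  then have s: "s = u + u * s" by simp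
  have sI: "s \<notin> I"
  proof
    assume "s \<in> I"
    then have "s - u * s \<in> I" by (intro ideal_diff[OF I(1)] ideal_mult_left[OF I(1)])
    moreover have "s - u * s = u" using s by (simp add: algebra_simps)
    ultimately show False using u(2) by simp
  qed
  define w where "w = Unitization (2 *\<^sub>R s) 1"
  have dw: "1 - w = Unitization (- 2 *\<^sub>R s) 0" unfolding w_def by (simp add: unitization_defs)
  obtain y p where y: "(\<lambda>k. p k * (1 - w)) \<longlonglongrightarrow> y" "\<And>n. \<exists>z. 1 - w = z * y ^ n"
    using power_factorization[OF cayley_transform_power_bounded[OF u(1) s], folded w_def] by blast
  have "(\<lambda>k. scalar_part (p k * (1 - w))) \<longlonglongrightarrow> scalar_part y"
    by (rule tendsto_scalar_part[OF y(1)])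
  then have "scalar_part y = 0"
    unfolding dw by (simp add: times_unitization_def LIMSEQ_const_iff)
  then have y0: "y = Unitization (vector_part y) 0" by (cases y) simp
  have sq: "y ^ (2 ^ k) = Unitization (((\<lambda>x. x * x) ^^ k) (vector_part y)) 0" for k
  proof (induction k)
    case (Suc k)
    have "y ^ (2 ^ Suc k) = y ^ (2 ^ k) * y ^ (2 ^ k)" by (simp add: power_add[symmetric] mult_2)
    then show ?case using Suc by (simp add: times_unitization_def)
  qed (simp add: y0[symmetric])
  have "((\<lambda>x. x * x) ^^ k) (vector_part y) \<notin> I" (is "?q \<notin> I") for k
  proof
    assume q: "?q \<in> I"
    obtain z where "1 - w = z * y ^ (2 ^ k)" using y(2) by blast
    then have "- 2 *\<^sub>R s = vector_part z * ?q + scalar_part z *\<^sub>R ?q"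
      unfolding dw sq by (simp add: times_unitization_def)
    also have "\<dots> \<in> I"
      by (intro ideal_add[OF I(1)] ideal_mult_left[OF I(1)] ideal_scaleR[OF I(1)] q)
    finally have "(- 1/2) *\<^sub>R (- 2) *\<^sub>R s \<in> I" by (rule ideal_scaleR[OF I(1)])
    then show False using sI by simp
  qed
  then show thesis using that by blast
qed

text \<open>A two-sided ideal maximal among those avoiding \<open>y, y\<^sup>2, y\<^sup>4, \<dots>\<close> is prime. If
  \<open>x a z \<in> Q\<close> for all \<open>a\<close> and neither \<open>x\<close> nor \<open>z\<close> is in \<open>Q\<close>, then the ideal \<open>S\<close> of all elements
  that \<open>z\<close> annihilates in this sense is larger than \<open>Q\<close>, and so is the ideal \<open>T\<close> of all
  elements that \<open>S\<close> annihilates. Both contain an iterated square \<open>b\<close>, and then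
  \<open>b (b b) b \<in> Q\<close>.\<close>

lemma prime_ideal_above:
  fixes I :: "'a::cstar_algebra set"
  assumes I: "two_sided_ideal I" "I \<noteq> UNIV"
  obtains Q where "prime_ideal Q" "I \<subseteq> Q"
proof -
  obtain y where y: "\<And>k. ((\<lambda>x. x * x) ^^ k) y \<notin> I" using squares_outside_ideal[OF I] by blast
  define b where "b = (\<lambda>k. ((\<lambda>x. x * x) ^^ k) y)"
  have b_Suc: "b (Suc k) = b k * b k" for k unfolding b_def by simp
  define \<A> where "\<A> = {J. two_sided_ideal J \<and> I \<subseteq> J \<and> (\<forall>k. b k \<notin> J)}"
  have "\<exists>Q\<in>\<A>. \<forall>J\<in>\<A>. Q \<subseteq> J \<longrightarrow> J = Q"
  proof (rule subset_Zorn_nonempty)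
    show "\<A> \<noteq> {}" using I y unfolding \<A>_def b_def by auto
    fix \<C> assume \<C>: "\<C> \<noteq> {}" "subset.chain \<A> \<C>"
    have ideal: "two_sided_ideal J" if "J \<in> \<C>" for J
      using \<C>(2) that unfolding subset.chain_def \<A>_def by auto
    have "two_sided_ideal (\<Union>\<C>)"
    proof (rule two_sided_idealI)
      show "0 \<in> \<Union>\<C>" using \<C>(1) ideal ideal_0 by auto
      fix x z assume "x \<in> \<Union>\<C>" "z \<in> \<Union>\<C>"
      then obtain J J' where J: "x \<in> J" "J \<in> \<C>" "z \<in> J'" "J' \<in> \<C>" by auto
      then have "J \<subseteq> J' \<or> J' \<subseteq> J" using \<C>(2) unfolding subset_chain_def by auto
      then show "x + z \<in> \<Union>\<C>"
      proof
        assume "J \<subseteq> J'"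
        then have "x + z \<in> J'" using J ideal_add[OF ideal[OF J(4)]] by auto
        then show ?thesis using J(4) by auto
      next
        assume "J' \<subseteq> J"
        then have "x + z \<in> J" using J ideal_add[OF ideal[OF J(2)]] by auto
        then show ?thesis using J(2) by auto
      qed
    next
      fix a x c assume "x \<in> \<Union>\<C>"
      then obtain J where J: "x \<in> J" "J \<in> \<C>" by auto
      note I = ideal[OF J(2)]
      show "c *\<^sub>C x \<in> \<Union>\<C>" "a * x \<in> \<Union>\<C>" "x * a \<in> \<Union>\<C>"
        using J(2) ideal_scaleC[OF I J(1)] ideal_mult_left[OF I J(1)] ideal_mult_right[OF I J(1)]
        by auto
    qed
    moreover have "I \<subseteq> \<Union>\<C>" "\<forall>k. b k \<notin> \<Union>\<C>"
      using \<C> unfolding subset_chain_def \<A>_def by (fast, auto)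
    ultimately show "\<Union>\<C> \<in> \<A>" unfolding \<A>_def by simp
  qed
  then obtain Q where Q: "two_sided_ideal Q" "I \<subseteq> Q" "\<And>k. b k \<notin> Q"
    and max: "\<And>J. two_sided_ideal J \<Longrightarrow> Q \<subseteq> J \<Longrightarrow> (\<And>k. b k \<notin> J) \<Longrightarrow> J = Q"
    unfolding \<A>_def by auto
  have larger: "\<exists>m. \<forall>k\<ge>m. b k \<in> J"
    if J: "two_sided_ideal J" "Q \<subseteq> J" "x \<in> J" "x \<notin> Q" for J x
  proof -
    obtain m where m: "b m \<in> J" using max[OF J(1,2)] J(3,4) by auto
    have "b k \<in> J" if "k \<ge> m" for k
      using that by (induction k rule: dec_induct) (simp_all add: m b_Suc ideal_mult_left[OF J(1)])
    then show ?thesis by auto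
  qed
  have "x \<in> Q \<or> z \<in> Q" if xz: "\<And>a. x * a * z \<in> Q" for x z
  proof (rule ccontr)
    assume "\<not> (x \<in> Q \<or> z \<in> Q)"
    then have notin: "x \<notin> Q" "z \<notin> Q" by auto
    define S where "S = {v. \<forall>a. v * a * z \<in> Q}"
    define T where "T = {t. \<forall>v\<in>S. \<forall>a. v * a * t \<in> Q}"
    have S: "two_sided_ideal S"
    proof (rule two_sided_idealI)
      show "a * v \<in> S" if "v \<in> S" for a v
        using that ideal_mult_left[OF Q(1)] unfolding S_def by (simp add: mult.assoc)
      show "v * a \<in> S" if "v \<in> S" for a v
        using that unfolding S_def mem_Collect_eq by (metis mult.assoc)
    qed (simp_all add: S_def distrib_right mult_scaleC_left ideal_0[OF Q(1)] ideal_add[OF Q(1)]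
        ideal_scaleC[OF Q(1)])
    have T: "two_sided_ideal T"
    proof (rule two_sided_idealI)
      show "a * t \<in> T" if "t \<in> T" for a t
        using that unfolding T_def mem_Collect_eq by (metis mult.assoc)
      show "t * a \<in> T" if "t \<in> T" for a t
        using that ideal_mult_right[OF Q(1)] unfolding T_def by (simp add: mult.assoc[symmetric])
    qed (simp_all add: T_def distrib_left mult_scaleC_right ideal_0[OF Q(1)] ideal_add[OF Q(1)]
        ideal_scaleC[OF Q(1)])
    have "Q \<subseteq> S" unfolding S_def by (auto intro: ideal_mult_right[OF Q(1)])
    moreover have "x \<in> S" using xz unfolding S_def by simp
    ultimately obtain m where m: "\<forall>k\<ge>m. b k \<in> S" using larger[OF S _ _ notin(1)] by auto
    have "Q \<subseteq> T" unfolding T_def by (auto intro: ideal_mult_left[OF Q(1)])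
    moreover have "z \<in> T" unfolding T_def S_def by simp
    ultimately obtain n where n: "\<forall>k\<ge>n. b k \<in> T" using larger[OF T _ _ notin(2)] by auto
    let ?k = "max m n"
    have "b ?k * (b ?k * b ?k) * b ?k \<in> Q" using m n unfolding T_def by simp
    then have "b (Suc (Suc ?k)) \<in> Q" by (simp add: b_Suc mult.assoc)
    then show False using Q(3) by simp
  qed
  moreover have "Q \<noteq> UNIV" using Q(3) by auto
  ultimately have "prime_ideal Q" using Q(1) unfolding prime_ideal_def by simp
  then show thesis using that Q(2) by simp
qed

section \<open>Fully noncentral and prime Lie ideals\<close>

text \<open>The elements \<open>v\<close> with \<open>[A, v] \<subseteq> L\<close> include \<open>L\<close> and, by \<open>[a, x y] = [a x, y] + [y a, x]\<close>,
  also \<open>L\<^sup>2\<close>. Hence the largest ideal \<open>J\<close> among them contains \<open>[L, L]\<close>. Were \<open>J\<close> proper, then \<open>L\<close>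
  would be commutative and hence central modulo some prime ideal above \<open>J\<close>.\<close>

lemma commutators_in_fully_noncentral:
  assumes L: "lie_ideal L" and full: "fully_noncentral L"
  shows "commutator a b \<in> L"
proof -
  note sub = lie_ideal_subspace[OF L]
  define W where "W = {v. \<forall>a. commutator a v \<in> L}"
  have W: "csubspace W"
    unfolding W_def complex_vector.subspace_def
    by (simp add: commutator_add_right commutator_scaleC_right complex_vector.subspace_0[OF sub]
        complex_vector.subspace_add[OF sub] complex_vector.subspace_scale[OF sub])
  have LW: "L \<subseteq> W" unfolding W_def by (auto intro: lie_ideal_commutator[OF L])
  have LLW: "x * y \<in> W" if "x \<in> L" "y \<in> L" for x y
  proof -
    have "commutator a (x * y) = commutator (a * x) y + commutator (y * a) x" for a
      unfolding commutator_def by (simp add: algebra_simps)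
    then show ?thesis
      unfolding W_def
      by (simp add: complex_vector.subspace_add[OF sub] lie_ideal_commutator[OF L] that)
  qed
  define J where "J = {v \<in> W. \<forall>a b. a * v \<in> W \<and> v * b \<in> W \<and> a * v * b \<in> W}"
  have J: "two_sided_ideal J"
  proof (rule two_sided_idealI)
    show "a * v \<in> J" if "v \<in> J" for a v
      using that unfolding J_def by (simp add: mult.assoc[symmetric])
    show "v * a \<in> J" if "v \<in> J" for a v
      using that unfolding J_def by (simp add: mult.assoc[symmetric]) (simp add: mult.assoc)
  qed (simp_all add: J_def distrib_left distrib_right mult_scaleC_left mult_scaleC_right
      complex_vector.subspace_0[OF W] complex_vector.subspace_add[OF W]
      complex_vector.subspace_scale[OF W])
  have "J = UNIV"
  proof (rule ccontr)
    assume "J \<noteq> UNIV"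
    then obtain Q where Q: "prime_ideal Q" "J \<subseteq> Q" using prime_ideal_above[OF J] by auto
    have "commutator x y \<in> J" if "x \<in> L" "y \<in> L" for x y
      using ideal_of_lie_commutators[OF L W LW LLW that] unfolding J_def by simp
    then have comm: "commutator x y \<in> Q" if "x \<in> L" "y \<in> L" for x y
      using Q(2) that by auto
    have "commutator a x \<in> Q" if "x \<in> L" for a x
      by (rule prime_ideal_lie_ideal_commutative[OF Q(1) L comm that])
    then show False
      using full prime_ideal_is_ideal[OF Q(1)] prime_ideal_proper[OF Q(1)]
      unfolding fully_noncentral_iff by auto
  qed
  then have "b \<in> W" unfolding J_def by auto
  then show ?thesis unfolding W_def by simp
qed

text \<open>This Lie ideal is the preimage of the centre of the quotient. It is proper since \<open>Q\<close> would
  otherwise contain all products of commutators.\<close>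

lemma prime_lie_ideal_of_prime_ideal:
  assumes gen: "generated_by_commutators TYPE('a::cstar_algebra)"
    and Q: "prime_ideal (Q :: 'a set)"
  shows "prime_lie_ideal {x. \<forall>a. commutator a x \<in> Q}" (is "prime_lie_ideal ?P")
proof -
  note I = prime_ideal_is_ideal[OF Q]
  have QP: "Q \<subseteq> ?P"
    by (auto intro: ideal_commutator[OF I])
  have sub: "csubspace ?P"
    unfolding complex_vector.subspace_def
    by (simp add: commutator_add_right commutator_scaleC_right ideal_0[OF I] ideal_add[OF I]
        ideal_scaleC[OF I])
  have lie: "lie_ideal ?P"
    unfolding lie_ideal_iff using sub QP by blast
  have "?P \<noteq> UNIV"
  proof
    assume "?P = UNIV"
    then have comm: "commutator a b \<in> Q" for a b by blast
    have prods: "p \<in> Q" if "p \<in> commutator_products" for p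
      using that by induction (auto intro: comm ideal_mult_right[OF I])
    have "sum_list ps \<in> Q" if "set ps \<subseteq> commutator_products" for ps
      using that by (induction ps) (auto intro: ideal_add[OF I] prods ideal_0[OF I])
    then have "x \<in> Q" for x
      using gen unfolding generated_by_commutators_def by metis
    then have "Q = UNIV" by auto
    then show False using prime_ideal_proper[OF Q] by blast
  qed
  moreover have "K1 \<subseteq> ?P \<or> K2 \<subseteq> ?P"
    if K: "lie_ideal K1" "lie_ideal K2" "commutator_span K1 K2 \<subseteq> ?P" for K1 K2
  proof -
    have "commutator a (commutator x y) \<in> Q" if "x \<in> K1" "y \<in> K2" for a x y
      using commutator_in_commutator_span[OF that] K(3) by blast
    from prime_ideal_lie_ideals[OF Q K(1,2) this] show ?thesis by blast
  qed
  ultimately show ?thesis using lie unfolding prime_lie_ideal_def by blast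
qed

theorem theorem3:
  fixes L :: "'a::cstar_algebra set"
  assumes "generated_by_commutators TYPE('a)"
    and "lie_ideal L"
  shows "fully_noncentral L \<longleftrightarrow> \<not> (\<exists>P. prime_lie_ideal P \<and> L \<subseteq> P)"
proof
  assume full: "fully_noncentral L"
  show "\<not> (\<exists>P. prime_lie_ideal P \<and> L \<subseteq> P)"
  proof
    assume "\<exists>P. prime_lie_ideal P \<and> L \<subseteq> P"
    then obtain P where P: "prime_lie_ideal P" "L \<subseteq> P" by auto
    have comm: "commutator a b \<in> P" for a b
      using commutators_in_fully_noncentral[OF assms(2) full] P(2) by auto
    have "csubspace P" using P(1) lie_ideal_subspace unfolding prime_lie_ideal_def by auto
    then have "commutator_span UNIV UNIV \<subseteq> P"
      unfolding commutator_span_def by (intro complex_vector.span_minimal) (auto simp: comm)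
    moreover have "lie_ideal (UNIV :: 'a set)" by (simp add: lie_ideal_iff)
    ultimately show False using P(1) unfolding prime_lie_ideal_def by (metis top.extremum_uniqueI)
  qed
next
  assume no_prime: "\<not> (\<exists>P. prime_lie_ideal P \<and> L \<subseteq> P)"
  show "fully_noncentral L"
  proof (rule ccontr)
    assume "\<not> fully_noncentral L"
    then obtain I where I: "two_sided_ideal I" "I \<noteq> UNIV" "\<forall>x\<in>L. \<forall>a. commutator a x \<in> I"
      unfolding fully_noncentral_iff by auto
    obtain Q where Q: "prime_ideal Q" "I \<subseteq> Q" using prime_ideal_above[OF I(1,2)] by auto
    have "L \<subseteq> {x. \<forall>a. commutator a x \<in> Q}" using I(3) Q(2) by auto
    then show False using no_prime prime_lie_ideal_of_prime_ideal[OF assms(1) Q(1)] by auto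
  qed
qed

end
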